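(* Let $\mathfrak{g}$ be a finite-dimensional complex Lie algebra and let $x\cdot y=[\phi(x),y]$ be an inner CPA-structure on $\mathfrak{g}$, with $\phi$ a Lie algebra endomorphism. Let $\mathfrak{g}=\bigoplus_\alpha\mathfrak{g}_\alpha$ be the generalized eigenspace decomposition of $\mathfrak{g}$ with respect to $\phi$ (with $\mathfrak{g}_\gamma=0$ if $\gamma$ is not an eigenvalue). Then $[\mathfrak{g}_\alpha,\mathfrak{g}_\beta]\subseteq\mathfrak{g}_{\alpha\beta}$ for all $\alpha,\beta$, and $[\mathfrak{g}_\alpha,\mathfrak{g}_\beta]\neq0$ implies $\alpha+\beta=0$.
   Context: A CPA-structure on $\mathfrak{g}$ is a bilinear product $x\cdot y$ satisfying, for all $x,y,z$: $x\cdot y=y\cdot x$; $[x,y]\cdot z=x\cdot(y\cdot z)-y\cdot(x\cdot z)$; $x\cdot[y,z]=[x\cdot y,z]+[y,x\cdot z]$. It is inner if $x\cdot y=[\phi(x),y]$ with $\phi$ a Lie algebra homomorphism $\mathfrak{g}\to\mathfrak{g}$. *)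

theory Defs
  imports "HOL-Analysis.Analysis"
begin

text \<open>A finite-dimensional complex Lie algebra is modelled (up to linear isomorphism)
  as the coordinate space complex^'n (for an arbitrary finite index type 'n)
  equipped with a bracket br.\<close>

definition lie_algebra :: "(complex^'n \<Rightarrow> complex^'n \<Rightarrow> complex^'n) \<Rightarrow> bool" where
  "lie_algebra br \<longleftrightarrow>
     (\<forall>x. Vector_Spaces.linear (*s) (*s) (br x)) \<and>
     (\<forall>y. Vector_Spaces.linear (*s) (*s) (\<lambda>x. br x y)) \<and>
     (\<forall>x. br x x = 0) \<and>
     (\<forall>x y z. br x (br y z) + br y (br z x) + br z (br x y) = 0)"

text \<open>Lie algebra endomorphism.\<close>
definition lie_hom :: "(complex^'n \<Rightarrow> complex^'n \<Rightarrow> complex^'n) \<Rightarrow> (complex^'n \<Rightarrow> complex^'n) \<Rightarrow> bool" where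
  "lie_hom br \<phi> \<longleftrightarrow> Vector_Spaces.linear (*s) (*s) \<phi> \<and> (\<forall>x y. \<phi> (br x y) = br (\<phi> x) (\<phi> y))"

text \<open>CPA-structure: a bilinear product satisfying the three axioms.\<close>
definition CPA_structure :: "(complex^'n \<Rightarrow> complex^'n \<Rightarrow> complex^'n) \<Rightarrow> (complex^'n \<Rightarrow> complex^'n \<Rightarrow> complex^'n) \<Rightarrow> bool" where
  "CPA_structure br p \<longleftrightarrow>
     (\<forall>x. Vector_Spaces.linear (*s) (*s) (p x)) \<and>
     (\<forall>y. Vector_Spaces.linear (*s) (*s) (\<lambda>x. p x y)) \<and>
     (\<forall>x y. p x y = p y x) \<and>
     (\<forall>x y z. p (br x y) z = p x (p y z) - p y (p x z)) \<and>
     (\<forall>x y z. p x (br y z) = br (p x y) z + br y (p x z))"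

text \<open>Inner CPA-structure: x\<cdot>y = [\<phi> x, y] with \<phi> a Lie algebra homomorphism.\<close>
definition inner_CPA :: "(complex^'n \<Rightarrow> complex^'n \<Rightarrow> complex^'n) \<Rightarrow> (complex^'n \<Rightarrow> complex^'n) \<Rightarrow> bool" where
  "inner_CPA br \<phi> \<longleftrightarrow> lie_hom br \<phi> \<and> CPA_structure br (\<lambda>x y. br (\<phi> x) y)"

text \<open>Generalized eigenspace of \<phi> for \<alpha> (equal to {0} if \<alpha> is not an eigenvalue).\<close>
definition gen_eigenspace :: "(complex^'n \<Rightarrow> complex^'n) \<Rightarrow> complex \<Rightarrow> (complex^'n) set" where
  "gen_eigenspace \<phi> \<alpha> = {x. \<exists>k. ((\<lambda>v. \<phi> v - \<alpha> *s v) ^^ k) x = 0}"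

text \<open>[A,B]: the subspace spanned by all brackets [a,b] with a in A, b in B.\<close>
definition bracket_space :: "(complex^'n \<Rightarrow> complex^'n \<Rightarrow> complex^'n) \<Rightarrow> (complex^'n) set \<Rightarrow> (complex^'n) set \<Rightarrow> (complex^'n) set" where
  "bracket_space br A B = vec.span {br a b | a b. a \<in> A \<and> b \<in> B}"

end

theory Submission
  imports Defs
begin

text \<open>Write \<open>D\<^sub>a = \<phi> - a\<close>. Since \<phi> is a Lie algebra endomorphism,
  \<open>D\<^sub>a\<^sub>b[x,y] = [D\<^sub>a x, D\<^sub>b y] + b[D\<^sub>a x, y] + a[x, D\<^sub>b y]\<close>,
  and since \<open>[\<phi> x, y] = [\<phi> y, x]\<close> by commutativity of the CPA-product,
  \<open>(a + b)[x,y] = -[D\<^sub>a x, y] - [x, D\<^sub>b y]\<close>. In both identities every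
  bracket on the right has lowered the nilpotency index of \<open>x\<close> or of \<open>y\<close>, so
  induction on the sum of the indices shows that \<open>[x,y]\<close> is a generalized
  \<open>ab\<close>-eigenvector, and that it vanishes unless \<open>a + b = 0\<close>.\<close>

lemma linear_funpow:
  fixes f :: "complex^'n \<Rightarrow> complex^'n"
  assumes "Vector_Spaces.linear (*s) (*s) f"
  shows "Vector_Spaces.linear (*s) (*s) (f ^^ k)"
proof (induction k)
  case 0
  then show ?case using vec.linear_id by (simp add: id_def)
next
  case (Suc k)
  then show ?case
    using Vector_Spaces.linear_compose[OF Suc assms] by (simp add: funpow_Suc_right comp_def)
qed

lemma subspace_eventually_vanishing:
  fixes g :: "complex^'n \<Rightarrow> complex^'n"
  assumes "Vector_Spaces.linear (*s) (*s) g"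
  shows "vec.subspace {x. \<exists>k. (g ^^ k) x = 0}"
proof -
  note lin = linear_funpow[OF assms]
  have vanish_later: "(g ^^ (j + k)) x = 0" if "(g ^^ k) x = 0" for j k x
    using that vec.linear_0[OF lin] by (simp add: funpow_add)
  show ?thesis
    unfolding vec.subspace_def
  proof (intro conjI ballI allI)
    fix x y assume "x \<in> {x. \<exists>k. (g ^^ k) x = 0}" "y \<in> {x. \<exists>k. (g ^^ k) x = 0}"
    then obtain i j where "(g ^^ i) x = 0" "(g ^^ j) y = 0" by auto
    then have "(g ^^ (j + i)) x = 0" "(g ^^ (i + j)) y = 0"
      using vanish_later by blast+
    then have "(g ^^ (i + j)) (x + y) = 0"
      by (simp add: vec.linear_add[OF lin] add.commute)
    then show "x + y \<in> {x. \<exists>k. (g ^^ k) x = 0}" by blast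
  qed (use vec.linear_0[OF lin] vec.linear_scale[OF lin] in fastforce)+
qed

lemma subspace_gen_eigenspace:
  assumes "Vector_Spaces.linear (*s) (*s) \<phi>"
  shows "vec.subspace (gen_eigenspace \<phi> a)"
  unfolding gen_eigenspace_def
  by (rule subspace_eventually_vanishing[OF vec.linear_compose_sub[OF assms vec.linear_scale_self]])

lemma bracket_space_subset:
  assumes "\<And>a b. a \<in> A \<Longrightarrow> b \<in> B \<Longrightarrow> br a b \<in> S" and "vec.subspace S"
  shows "bracket_space br A B \<subseteq> S"
  unfolding bracket_space_def by (rule vec.span_minimal) (use assms in blast)+

locale bilinear_bracket =
  fixes br :: "complex^'n \<Rightarrow> complex^'n \<Rightarrow> complex^'n"
  assumes linear_right: "Vector_Spaces.linear (*s) (*s) (br x)"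
    and linear_left: "Vector_Spaces.linear (*s) (*s) (\<lambda>x. br x y)"
begin

lemma zero_left [simp]: "br 0 y = 0"
  using vec.linear_0[OF linear_left] .

lemma zero_right [simp]: "br x 0 = 0"
  using vec.linear_0[OF linear_right] .

lemma diff_left: "br (x - x') y = br x y - br x' y"
  using vec.linear_diff[OF linear_left] .

lemma diff_right: "br x (y - y') = br x y - br x y'"
  using vec.linear_diff[OF linear_right] .

lemma scale_left: "br (c *s x) y = c *s br x y"
  using vec.linear_scale[OF linear_left] .

lemma scale_right: "br x (c *s y) = c *s br x y"
  using vec.linear_scale[OF linear_right] .

lemma gen_eigenvector_bracket_mult:
  assumes lin: "Vector_Spaces.linear (*s) (*s) \<phi>"
    and hom: "\<And>x y. \<phi> (br x y) = br (\<phi> x) (\<phi> y)"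
    and "((\<lambda>v. \<phi> v - a *s v) ^^ p) x = 0" "((\<lambda>v. \<phi> v - b *s v) ^^ q) y = 0" "p + q \<le> k"
  shows "((\<lambda>v. \<phi> v - (a * b) *s v) ^^ k) (br x y) = 0"
  using assms(3-5)
proof (induction k arbitrary: p q x y)
  case 0
  then show ?case by simp
next
  case (Suc k)
  let ?D = "\<lambda>v. \<phi> v - (a * b) *s v"
  note lin_D = linear_funpow[OF vec.linear_compose_sub[OF lin vec.linear_scale_self]]
  show ?case
  proof (cases "p = 0 \<or> q = 0")
    case True
    then have "br x y = 0" using Suc.prems by auto
    then show ?thesis using vec.linear_0[OF lin_D] by metis
  next
    case False
    then obtain p' q' where pq: "p = Suc p'" "q = Suc q'" by (meson not0_implies_Suc)
    have x': "((\<lambda>v. \<phi> v - a *s v) ^^ p') (\<phi> x - a *s x) = 0"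
      and y': "((\<lambda>v. \<phi> v - b *s v) ^^ q') (\<phi> y - b *s y) = 0"
      using Suc.prems pq by (simp_all add: funpow_Suc_right del: funpow.simps)
    have D_bracket: "?D (br x y) =
        br (\<phi> x - a *s x) (\<phi> y - b *s y) + b *s br (\<phi> x - a *s x) y + a *s br x (\<phi> y - b *s y)"
      by (simp add: hom diff_left diff_right scale_left scale_right algebra_simps)
    have "(?D ^^ k) (br (\<phi> x - a *s x) (\<phi> y - b *s y)) = 0"
      "(?D ^^ k) (br (\<phi> x - a *s x) y) = 0"
      "(?D ^^ k) (br x (\<phi> y - b *s y)) = 0"
      using Suc.IH[OF x' y'] Suc.IH[OF x' Suc.prems(2)] Suc.IH[OF Suc.prems(1) y'] Suc.prems(3) pq
      by simp_all
    then have "(?D ^^ k) (?D (br x y)) = 0"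
      unfolding D_bracket by (simp add: vec.linear_add[OF lin_D] vec.linear_scale[OF lin_D])
    then show ?thesis by (simp add: funpow_Suc_right del: funpow.simps)
  qed
qed

lemma gen_eigenvector_bracket_zero:
  assumes skew: "\<And>x y. br x (\<phi> y) = - br (\<phi> x) y"
    and "((\<lambda>v. \<phi> v - a *s v) ^^ p) x = 0" "((\<lambda>v. \<phi> v - b *s v) ^^ q) y = 0" "p + q \<le> k"
    and "a + b \<noteq> 0"
  shows "br x y = 0"
  using assms(2-4)
proof (induction k arbitrary: p q x y)
  case 0
  then show ?case by simp
next
  case (Suc k)
  show ?case
  proof (cases "p = 0 \<or> q = 0")
    case True
    then show ?thesis using Suc.prems by auto
  next
    case False
    then obtain p' q' where pq: "p = Suc p'" "q = Suc q'" by (meson not0_implies_Suc)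
    have x': "((\<lambda>v. \<phi> v - a *s v) ^^ p') (\<phi> x - a *s x) = 0"
      and y': "((\<lambda>v. \<phi> v - b *s v) ^^ q') (\<phi> y - b *s y) = 0"
      using Suc.prems pq by (simp_all add: funpow_Suc_right del: funpow.simps)
    have "(a + b) *s br x y = - br (\<phi> x - a *s x) y - br x (\<phi> y - b *s y)"
      by (simp add: skew diff_left diff_right scale_left scale_right algebra_simps)
    also have "\<dots> = 0"
      using Suc.IH[OF x' Suc.prems(2)] Suc.IH[OF Suc.prems(1) y'] Suc.prems(3) pq by simp
    finally show ?thesis using \<open>a + b \<noteq> 0\<close> by (metis vec.scale_eq_0_iff)
  qed
qed

end

lemma lie_algebra_bilinear_bracket: "lie_algebra br \<Longrightarrow> bilinear_bracket br"
  unfolding lie_algebra_def by (intro bilinear_bracket.intro) blast+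

lemma lie_algebra_anticommute:
  assumes "lie_algebra br"
  shows "br y x = - br x y"
proof -
  interpret bilinear_bracket br using lie_algebra_bilinear_bracket[OF assms] .
  have "br (x + y) (x + y) = 0" "br x x = 0" "br y y = 0"
    using assms unfolding lie_algebra_def by blast+
  then have "br y x + br x y = 0"
    by (simp add: vec.linear_add[OF linear_left] vec.linear_add[OF linear_right])
  then show ?thesis by (simp add: eq_neg_iff_add_eq_0)
qed

lemma inner_CPA_skew:
  assumes "lie_algebra br" and "inner_CPA br \<phi>"
  shows "br x (\<phi> y) = - br (\<phi> x) y"
proof -
  have "br (\<phi> y) x = br (\<phi> x) y"
    using assms(2) unfolding inner_CPA_def CPA_structure_def by blast
  then show ?thesis using lie_algebra_anticommute[OF assms(1)] by (metis minus_minus)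
qed

theorem lemma2p12:
  fixes br :: "complex^'n \<Rightarrow> complex^'n \<Rightarrow> complex^'n"
    and \<phi> :: "complex^'n \<Rightarrow> complex^'n"
  assumes "lie_algebra br"
    and "inner_CPA br \<phi>"
  shows "\<forall>\<alpha> \<beta>. bracket_space br (gen_eigenspace \<phi> \<alpha>) (gen_eigenspace \<phi> \<beta>) \<subseteq> gen_eigenspace \<phi> (\<alpha> * \<beta>)
           \<and> (bracket_space br (gen_eigenspace \<phi> \<alpha>) (gen_eigenspace \<phi> \<beta>) \<noteq> {0} \<longrightarrow> \<alpha> + \<beta> = 0)"
proof (intro allI conjI impI)
  interpret bilinear_bracket br using lie_algebra_bilinear_bracket[OF assms(1)] .
  have lin: "Vector_Spaces.linear (*s) (*s) \<phi>" and hom: "\<And>x y. \<phi> (br x y) = br (\<phi> x) (\<phi> y)"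
    using assms(2) unfolding inner_CPA_def lie_hom_def by blast+
  fix \<alpha> \<beta> :: complex
  let ?B = "bracket_space br (gen_eigenspace \<phi> \<alpha>) (gen_eigenspace \<phi> \<beta>)"
  show "?B \<subseteq> gen_eigenspace \<phi> (\<alpha> * \<beta>)"
    using gen_eigenvector_bracket_mult[OF lin hom _ _ order_refl]
    by (intro bracket_space_subset subspace_gen_eigenspace[OF lin]) (unfold gen_eigenspace_def, blast)
  show "\<alpha> + \<beta> = 0" if "?B \<noteq> {0}"
  proof (rule ccontr)
    assume "\<alpha> + \<beta> \<noteq> 0"
    then have "?B \<subseteq> {0}"
      using gen_eigenvector_bracket_zero[OF inner_CPA_skew[OF assms] _ _ order_refl]
      by (intro bracket_space_subset vec.subspace_single_0) (unfold gen_eigenspace_def, blast)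
    with that show False
      using vec.span_zero unfolding bracket_space_def by blast
  qed
qed

end
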